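(* Let $H\subset E$ and $(\nu_t)_{t>0}$, $(P_t)_{t\ge0}$ be as in the context, with $\dim H=\infty$, and assume that (HS) and (H) hold. Let $x\in E\setminus H$ and let $E_x$ be the Borel linear subspace of $E$ defined in the context. Then the function $1_{E_x}$ is invariant with respect to $(P_t)_{t\ge0}$ (i.e. $P_t1_{E_x}=1_{E_x}$ for all $t>0$), it is identically equal to one on $H$, and it is zero at $x$.
   Context: $(H,\langle\cdot,\cdot\rangle)$ is a separable real Hilbert space with norm $|\cdot|$; $(E,\langle\cdot,\cdot\rangle_E)$ is a Hilbert space with norm $\|\cdot\|$ such that $H\subset E$ continuously and densely; identifying $H$ with $H'$, $E'\subset H\subset E$; ${}_{E'}\langle\xi,z\rangle_E=\xi(z)$. (HS): the embedding $H\subset E$ is Hilbert–Schmidt. $\psi:H\to\mathbb C$ is a continuous negative definite function (so that $e^{-t\psi}$ is positive definite for each $t>0$) with $\psi(0)=0$. For $t>0$, $\nu_t$ is the probability measure on $(E,\mathcal B(E))$ with $\int_E e^{i\,{}_{E'}\langle\xi,z\rangle_E}\nu_t(dz)=e^{-t\psi(\xi)}$, $\xi\in E'$. $P_tf(y)=\int_Ef(y+w)\nu_t(dw)$. (H): (i) there is $C>0$ such that $\int_E {}_{E'}\langle\xi,z\rangle_E^2\,\nu_t(dz)\le C(1+t^2)|\xi|^2$ for all $\xi\in E'$, $t>0$; (ii) $\nu_t(H)=0$ for all $t>0$. Fix an orthonormal basis $\{e_n:n\ge1\}$ of $H$ contained in $E'$ and $\lambda_n\in(0,\infty)$ with $\sum_n\lambda_n<\infty$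 such that $\overline e_n:=e_n/\sqrt{\lambda_n}$, $n\ge1$, form an orthonormal basis of $E$ and $\lambda_n\,{}_{E'}\langle e_n,z\rangle_E=\langle e_n,z\rangle_E$ for all $n$ and $z\in E$ (such a basis exists by (HS)). Let $\alpha_n\in(0,\infty)$, $\alpha_n\nearrow\infty$, with $\sum_n\alpha_n\lambda_n<\infty$. For $x\in E\setminus H$, fix an orthonormal basis $\{e_n^x:n\ge1\}$ of $H$ with $e_n^x\in E'$, separating the points of $E$, with ${}_{E'}\langle e_n^x,x\rangle_E\ge2^{n/2}$ for all $n$ (such a basis exists), and define $$q_x(z):=\Big[\sum_{n=1}^\infty\alpha_n\lambda_n\,{}_{E'}\langle e_n,z\rangle_E^2+\Big(\sum_{n=1}^\infty2^{-n/2}|{}_{E'}\langle e_n^x,z\rangle_E|\Big)^2\Big]^{1/2},\quad z\in E,$$ $E_x:=\{z\in E:q_x(z)<\infty\}$. *)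

theory Defs
  imports "HOL-Probability.Probability"
begin

text \<open>
  The inclusion of \<open>H\<close> into \<open>E\<close> is a map \<open>j :: 'h \<Rightarrow> 'e\<close> between two types, so that the
  subset \<open>H\<close> of \<open>E\<close> is \<open>range j\<close>. The class \<open>polish_space\<close> on \<open>'h\<close> stands for
  completeness and separability.
\<close>

definition dense_embedding :: "('h::real_inner \<Rightarrow> 'e::real_inner) \<Rightarrow> bool" where
  "dense_embedding j \<longleftrightarrow> bounded_linear j \<and> inj j \<and> closure (range j) = UNIV"

definition orthonormal_basis :: "'i set \<Rightarrow> ('i \<Rightarrow> 'a::real_inner) \<Rightarrow> bool" where
  "orthonormal_basis I b \<longleftrightarrow>
     (\<forall>m\<in>I. \<forall>n\<in>I. b m \<bullet> b n = (if m = n then 1 else 0)) \<and> closure (span (b ` I)) = UNIV"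

definition Hilbert_Schmidt :: "('h::real_inner \<Rightarrow> 'e::real_inner) \<Rightarrow> bool" where
  "Hilbert_Schmidt j \<longleftrightarrow> bounded_linear j \<and>
     (\<exists>B. orthonormal_basis B (\<lambda>b. b) \<and> (\<lambda>b. (norm (j b))\<^sup>2) summable_on B)"

text \<open>
  Restricting a continuous functional on \<open>E\<close> to \<open>H\<close> and applying the Riesz isomorphism
  identifies the dual of \<open>E\<close> with a subset of \<open>H\<close>. The functional belonging to an element of
  this subset is unique because \<open>H\<close> is dense in \<open>E\<close>; it is the value of \<open>dual_pairing\<close>.
\<close>

definition dual_in :: "('h::real_inner \<Rightarrow> 'e::real_inner) \<Rightarrow> 'h set" where
  "dual_in j = {\<xi>. \<exists>L :: 'e \<Rightarrow>\<^sub>L real. \<forall>h. blinfun_apply L (j h) = \<xi> \<bullet> h}"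

definition dual_pairing :: "('h::real_inner \<Rightarrow> 'e::real_inner) \<Rightarrow> 'h \<Rightarrow> 'e \<Rightarrow> real" where
  "dual_pairing j \<xi> = blinfun_apply (THE L :: 'e \<Rightarrow>\<^sub>L real. \<forall>h. blinfun_apply L (j h) = \<xi> \<bullet> h)"

lemma dual_pairing_eqI:
  fixes L :: "'e::real_inner \<Rightarrow>\<^sub>L real"
  assumes "dense_embedding j" and L: "\<And>h. blinfun_apply L (j h) = \<xi> \<bullet> h"
  shows "dual_pairing j \<xi> = blinfun_apply L"
proof -
  have "M = L" if M: "\<forall>h. blinfun_apply M (j h) = \<xi> \<bullet> h" for M :: "'e \<Rightarrow>\<^sub>L real"
  proof (rule blinfun_eqI)
    fix z
    have "z \<in> closure (range j)"
      using assms(1) by (simp add: dense_embedding_def)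
    moreover have "closed {z. blinfun_apply M z = blinfun_apply L z}"
      by (intro closed_Collect_eq continuous_intros)
    moreover have "range j \<subseteq> {z. blinfun_apply M z = blinfun_apply L z}"
      using M L by auto
    ultimately show "blinfun_apply M z = blinfun_apply L z"
      using closure_minimal[of "range j" "{z. blinfun_apply M z = blinfun_apply L z}"] by auto
  qed
  then have "(THE M :: 'e \<Rightarrow>\<^sub>L real. \<forall>h. blinfun_apply M (j h) = \<xi> \<bullet> h) = L"
    using L by (intro the_equality) auto
  then show ?thesis
    by (simp only: dual_pairing_def)
qed

text \<open>
  Negative definiteness in the sense of Schoenberg and of Berg and Forst; complex values are
  allowed, so that the quadratic form is required to be real and nonnegative.
\<close>

definition negative_definite :: "('h::real_vector \<Rightarrow> complex) \<Rightarrow> bool" where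
  "negative_definite \<psi> \<longleftrightarrow>
     (\<forall>(n::nat) (\<xi> :: nat \<Rightarrow> 'h) (c :: nat \<Rightarrow> complex).
        (\<Sum>i<n. \<Sum>k<n. (\<psi> (\<xi> i) + cnj (\<psi> (\<xi> k)) - \<psi> (\<xi> i - \<xi> k)) * c i * cnj (c k)) \<in> \<real>\<^sub>\<ge>\<^sub>0)"

definition transition_op :: "(real \<Rightarrow> 'e measure) \<Rightarrow> real \<Rightarrow> ('e::real_vector \<Rightarrow> real) \<Rightarrow> 'e \<Rightarrow> real" where
  "transition_op \<nu> t f y = (\<integral>w. f (y + w) \<partial>\<nu> t)"

definition ennreal_sqrt :: "ennreal \<Rightarrow> ennreal" where
  "ennreal_sqrt s = (if s = \<infinity> then \<infinity> else ennreal (sqrt (enn2real s)))"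

text \<open>All sequences are indexed from \<open>1\<close>; the sums over \<open>n \<ge> 1\<close> are sums over \<open>Suc n\<close>.\<close>

definition q_norm ::
  "('h::real_inner \<Rightarrow> 'e::real_inner) \<Rightarrow> (nat \<Rightarrow> 'h) \<Rightarrow> (nat \<Rightarrow> real) \<Rightarrow> (nat \<Rightarrow> real) \<Rightarrow>
   (nat \<Rightarrow> 'h) \<Rightarrow> 'e \<Rightarrow> ennreal" where
  "q_norm j e lam \<alpha> ex z = ennreal_sqrt (
     (\<Sum>n. ennreal (\<alpha> (Suc n) * lam (Suc n) * (dual_pairing j (e (Suc n)) z)\<^sup>2)) +
     (\<Sum>n. ennreal (2 powr (- real (Suc n) / 2) * \<bar>dual_pairing j (ex (Suc n)) z\<bar>))\<^sup>2)"

definition E_sub ::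
  "('h::real_inner \<Rightarrow> 'e::real_inner) \<Rightarrow> (nat \<Rightarrow> 'h) \<Rightarrow> (nat \<Rightarrow> real) \<Rightarrow> (nat \<Rightarrow> real) \<Rightarrow>
   (nat \<Rightarrow> 'h) \<Rightarrow> 'e set" where
  "E_sub j e lam \<alpha> ex = {z. q_norm j e lam \<alpha> ex z < \<infinity>}"

end

theory Submission
  imports Defs
begin

text \<open>
  The second moment bound makes both series in \<open>q_x\<close> integrable term by term, so \<open>\<nu>\<^sub>t(E_x) = 1\<close>; a subspace of
  full measure satisfies \<open>y + w \<in> E_x \<longleftrightarrow> y \<in> E_x\<close> for almost every \<open>w\<close>, which is the invariance. At \<open>x\<close> every
  term of the second series is at least \<open>1\<close>.
\<close>

section \<open>Membership in \<open>E_x\<close> as convergence of two real series\<close>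

lemma ennreal_sqrt_less_top_iff: "ennreal_sqrt s < \<infinity> \<longleftrightarrow> s < \<infinity>"
  by (simp add: ennreal_sqrt_def less_top)

lemma summable_iff_suminf_less_top:
  fixes f :: "nat \<Rightarrow> real"
  assumes "\<And>n. 0 \<le> f n"
  shows "summable f \<longleftrightarrow> (\<Sum>n. ennreal (f n)) < \<infinity>"
proof
  assume "summable f"
  then show "(\<Sum>n. ennreal (f n)) < \<infinity>"
    using assms by (simp add: suminf_ennreal2)
next
  assume "(\<Sum>n. ennreal (f n)) < \<infinity>"
  then show "summable f"
    using assms by (intro summable_suminf_not_top) auto
qed

text \<open>This passes from extended nonnegative values to convergence of real series, where
  comparison tests apply. The sign assumption matters because \<open>ennreal\<close> truncates
  negative reals to 0.\<close>

lemma E_sub_iff_summable: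
  assumes "\<And>n. n \<ge> 1 \<Longrightarrow> 0 \<le> \<alpha> n * lam n"
  shows "z \<in> E_sub j e lam \<alpha> ex \<longleftrightarrow>
    summable (\<lambda>n. \<alpha> (Suc n) * lam (Suc n) * (dual_pairing j (e (Suc n)) z)\<^sup>2) \<and>
    summable (\<lambda>n. 2 powr (- real (Suc n) / 2) * \<bar>dual_pairing j (ex (Suc n)) z\<bar>)"
proof -
  \<comment> \<open>Neither addition nor squaring can hide an infinite value, so the two series may
    be treated separately.\<close>
  have "s + r\<^sup>2 < \<infinity> \<longleftrightarrow> s < \<infinity> \<and> r < \<infinity>" for s r :: ennreal
    by (cases s; cases r) (auto simp: power2_eq_square ennreal_mult_less_top)
  then show ?thesis
    using assms by (simp add: E_sub_def q_norm_def ennreal_sqrt_less_top_iff summable_iff_suminf_less_top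
        del: infinity_ennreal_def)
qed

section \<open>Linearity and measurability of the pairing, and its values on
  \<open>H\<close>\<close>

lemma linear_dual_pairing: "linear (dual_pairing j \<xi>)"
  unfolding dual_pairing_def by (intro bounded_linear.linear blinfun.bounded_linear_right)

lemma borel_measurable_dual_pairing [measurable]:
  fixes j :: "'h::real_inner \<Rightarrow> 'e::real_inner"
  shows "dual_pairing j \<xi> \<in> borel_measurable borel"
  unfolding dual_pairing_def by (intro borel_measurable_continuous_onI continuous_intros)

text \<open>Membership in \<open>dual_in\<close> supplies a continuous extension to
  \<open>E\<close>, and density of \<open>range j\<close> makes it unique, so the definite
  description in \<open>dual_pairing\<close> denotes it.\<close>

lemma dual_pairing_embedding:
  assumes "dense_embedding j" "\<xi> \<in> dual_in j"
  shows "dual_pairing j \<xi> (j h) = \<xi> \<bullet> h"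
proof -
  obtain L :: "'b \<Rightarrow>\<^sub>L real" where L: "\<And>h. blinfun_apply L (j h) = \<xi> \<bullet> h"
    using assms(2) by (auto simp: dual_in_def)
  show ?thesis
    using dual_pairing_eqI[OF assms(1) L] L by simp
qed

section \<open>\<open>E_x\<close> is a Borel linear subspace\<close>

lemma borel_E_sub: "E_sub j e lam \<alpha> ex \<in> sets borel"
proof -
  \<comment> \<open>Finiteness is unaffected by the square root; what remains is built from
    countable sums of Borel functions.\<close>
  have "E_sub j e lam \<alpha> ex = {z.
     (\<Sum>n. ennreal (\<alpha> (Suc n) * lam (Suc n) * (dual_pairing j (e (Suc n)) z)\<^sup>2)) +
     (\<Sum>n. ennreal (2 powr (- real (Suc n) / 2) * \<bar>dual_pairing j (ex (Suc n)) z\<bar>))\<^sup>2 < \<infinity>}"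
    by (simp only: E_sub_def q_norm_def ennreal_sqrt_less_top_iff)
  also have "\<dots> \<in> sets borel"
    by measurable
  finally show ?thesis .
qed

lemma subspace_E_sub:
  assumes "\<And>n. n \<ge> 1 \<Longrightarrow> 0 \<le> \<alpha> n * lam n"
  shows "subspace (E_sub j e lam \<alpha> ex)"
proof (rule subspaceI)
  show "0 \<in> E_sub j e lam \<alpha> ex"
    using assms by (simp add: E_sub_iff_summable linear_0[OF linear_dual_pairing])
next
  fix z w
  assume z: "z \<in> E_sub j e lam \<alpha> ex" and w: "w \<in> E_sub j e lam \<alpha> ex"
  \<comment> \<open>From \<open>2ab \<le> a^2 + b^2\<close>. It serves as a termwise majorant for
    the quadratic series; the second series needs only the triangle inequality.\<close>
  have "(a + b)\<^sup>2 \<le> 2 * a\<^sup>2 + 2 * b\<^sup>2" for a b :: real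
    using sum_squares_bound[of a b] by (simp add: power2_sum)
  then have square: "c * (a + b)\<^sup>2 \<le> 2 * (c * a\<^sup>2) + 2 * (c * b\<^sup>2)" if "0 \<le> c" for a b c :: real
    using mult_left_mono[OF _ that, of "(a + b)\<^sup>2" "2 * a\<^sup>2 + 2 * b\<^sup>2"] by (simp add: algebra_simps)
  have "summable (\<lambda>n. \<alpha> (Suc n) * lam (Suc n) * (dual_pairing j (e (Suc n)) (z + w))\<^sup>2)"
  proof (rule summable_comparison_test'[OF summable_add[OF summable_mult summable_mult]])
    show "summable (\<lambda>n. \<alpha> (Suc n) * lam (Suc n) * (dual_pairing j (e (Suc n)) z)\<^sup>2)"
      "summable (\<lambda>n. \<alpha> (Suc n) * lam (Suc n) * (dual_pairing j (e (Suc n)) w)\<^sup>2)"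
      using z w assms by (simp_all add: E_sub_iff_summable)
    show "norm (\<alpha> (Suc n) * lam (Suc n) * (dual_pairing j (e (Suc n)) (z + w))\<^sup>2) \<le>
      2 * (\<alpha> (Suc n) * lam (Suc n) * (dual_pairing j (e (Suc n)) z)\<^sup>2) +
      2 * (\<alpha> (Suc n) * lam (Suc n) * (dual_pairing j (e (Suc n)) w)\<^sup>2)" for n
      using assms[of "Suc n"] square by (simp add: linear_add[OF linear_dual_pairing])
  qed
  moreover have "summable (\<lambda>n. 2 powr (- real (Suc n) / 2) * \<bar>dual_pairing j (ex (Suc n)) (z + w)\<bar>)"
  proof (rule summable_comparison_test'[OF summable_add])
    show "summable (\<lambda>n. 2 powr (- real (Suc n) / 2) * \<bar>dual_pairing j (ex (Suc n)) z\<bar>)"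
      "summable (\<lambda>n. 2 powr (- real (Suc n) / 2) * \<bar>dual_pairing j (ex (Suc n)) w\<bar>)"
      using z w assms by (simp_all add: E_sub_iff_summable)
    show "norm (2 powr (- real (Suc n) / 2) * \<bar>dual_pairing j (ex (Suc n)) (z + w)\<bar>) \<le>
      2 powr (- real (Suc n) / 2) * \<bar>dual_pairing j (ex (Suc n)) z\<bar> +
      2 powr (- real (Suc n) / 2) * \<bar>dual_pairing j (ex (Suc n)) w\<bar>" for n
      by (simp add: linear_add[OF linear_dual_pairing] abs_mult flip: distrib_left)
  qed
  ultimately show "z + w \<in> E_sub j e lam \<alpha> ex"
    using assms by (simp add: E_sub_iff_summable)
next
  fix c :: real and z
  assume "z \<in> E_sub j e lam \<alpha> ex"
  then have "summable (\<lambda>n. \<alpha> (Suc n) * lam (Suc n) * (dual_pairing j (e (Suc n)) z)\<^sup>2)"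
    "summable (\<lambda>n. 2 powr (- real (Suc n) / 2) * \<bar>dual_pairing j (ex (Suc n)) z\<bar>)"
    using assms by (simp_all add: E_sub_iff_summable)
  \<comment> \<open>The first series is homogeneous of degree 2 and the second of degree 1 in
    absolute value, whence the two factors.\<close>
  from summable_mult[OF this(1), of "c\<^sup>2"] summable_mult[OF this(2), of "\<bar>c\<bar>"]
  show "c *\<^sub>R z \<in> E_sub j e lam \<alpha> ex"
    using assms
    by (simp add: E_sub_iff_summable linear_cmul[OF linear_dual_pairing] power_mult_distrib abs_mult mult_ac)
qed

section \<open>\<open>E_x\<close> has full measure\<close>

lemma summable_2_powr_half: "summable (\<lambda>n. 2 powr (- real (Suc n) / 2))"
proof -
  have "(\<lambda>n. 2 powr (- real (Suc n) / 2)) = (\<lambda>n. (2 powr (- 1 / 2)) ^ Suc n)"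
    by (simp add: powr_power del: power_Suc of_nat_Suc)
  \<comment> \<open>The right-hand side is 1, so the ratio of the geometric series is below
    1.\<close>
  moreover have "(2::real) powr (- 1 / 2) < 2 powr 0"
    by (intro powr_less_mono) auto
  ultimately show ?thesis
    by (simp add: summable_mult summable_geometric)
qed

text \<open>By monotone convergence the integral of the sum is the sum of the integrals, which is
  finite; a nonnegative function with finite integral is finite almost everywhere.\<close>

lemma AE_summable:
  fixes f :: "nat \<Rightarrow> 'a \<Rightarrow> real" and c :: "nat \<Rightarrow> real"
  assumes [measurable]: "\<And>n. f n \<in> borel_measurable M" and "\<And>n z. 0 \<le> f n z"
    and bound: "\<And>n. (\<integral>\<^sup>+z. ennreal (f n z) \<partial>M) \<le> ennreal (c n)"
    and "\<And>n. 0 \<le> c n" "summable c"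
  shows "AE z in M. summable (\<lambda>n. f n z)"
proof -
  have "(\<integral>\<^sup>+z. (\<Sum>n. ennreal (f n z)) \<partial>M) = (\<Sum>n. \<integral>\<^sup>+z. ennreal (f n z) \<partial>M)"
    by (intro nn_integral_suminf) measurable
  also have "\<dots> \<le> (\<Sum>n. ennreal (c n))"
    by (intro suminf_le bound summableI)
  also have "\<dots> < \<infinity>"
    using summable_iff_suminf_less_top[of c] assms(4,5) by blast
  finally have "AE z in M. (\<Sum>n. ennreal (f n z)) \<noteq> \<infinity>"
    by (intro nn_integral_PInf_AE) auto
  then show ?thesis
    by eventually_elim
      (simp add: summable_iff_suminf_less_top[OF assms(2)] top.not_eq_extremum)
qed

text \<open>\<open>AE_summable\<close> is applied to each series. Since the basis vectors have norm
  1, the moment bound is the same constant \<open>K\<close> for all of them, and convergence comes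
  from the weights alone.\<close>

lemma AE_E_sub:
  fixes j :: "'h::real_inner \<Rightarrow> 'e::real_inner" and K :: real
  assumes "prob_space M" and M [measurable_cong]: "sets M = sets borel" and "0 \<le> K"
    and second_moment: "\<And>\<xi>. \<xi> \<in> dual_in j \<Longrightarrow>
      (\<integral>\<^sup>+z. ennreal ((dual_pairing j \<xi> z)\<^sup>2) \<partial>M) \<le> ennreal (K * (norm \<xi>)\<^sup>2)"
    and e: "\<And>n. n \<ge> 1 \<Longrightarrow> e n \<in> dual_in j \<and> norm (e n) = 1"
    and ex: "\<And>n. n \<ge> 1 \<Longrightarrow> ex n \<in> dual_in j \<and> norm (ex n) = 1"
    and nonneg: "\<And>n. n \<ge> 1 \<Longrightarrow> 0 \<le> \<alpha> n * lam n"
    and "summable (\<lambda>n. \<alpha> (Suc n) * lam (Suc n))"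
  shows "AE z in M. z \<in> E_sub j e lam \<alpha> ex"
proof -
  interpret prob_space M by fact
  have "AE z in M. summable (\<lambda>n. \<alpha> (Suc n) * lam (Suc n) * (dual_pairing j (e (Suc n)) z)\<^sup>2)"
  proof (rule AE_summable)
    show "(\<integral>\<^sup>+z. ennreal (\<alpha> (Suc n) * lam (Suc n) * (dual_pairing j (e (Suc n)) z)\<^sup>2) \<partial>M)
        \<le> ennreal (\<alpha> (Suc n) * lam (Suc n) * K)" for n
      using second_moment[of "e (Suc n)"] e[of "Suc n"] nonneg[of "Suc n"] \<open>0 \<le> K\<close>
      by (simp add: ennreal_mult' nn_integral_cmult mult_left_mono)
    show "summable (\<lambda>n. \<alpha> (Suc n) * lam (Suc n) * K)"
      using assms by (intro summable_mult2)
  qed (use nonneg \<open>0 \<le> K\<close> in auto)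
  moreover have "AE z in M. summable (\<lambda>n. 2 powr (- real (Suc n) / 2) * \<bar>dual_pairing j (ex (Suc n)) z\<bar>)"
  proof (rule AE_summable)
    fix n
    \<comment> \<open>This reduces the first moments in the second series to second moments; the
      summand 1 integrates to 1 because \<open>M\<close> is a probability measure.\<close>
    have "\<bar>a\<bar> \<le> 1 + a\<^sup>2" for a :: real
      using sum_squares_bound[of "\<bar>a\<bar>" 1] by simp
    then have "(\<integral>\<^sup>+z. ennreal \<bar>dual_pairing j (ex (Suc n)) z\<bar> \<partial>M)
        \<le> (\<integral>\<^sup>+z. 1 + ennreal ((dual_pairing j (ex (Suc n)) z)\<^sup>2) \<partial>M)"
      by (intro nn_integral_mono) (simp add: ennreal_leI flip: ennreal_1 ennreal_plus)
    also have "\<dots> = 1 + (\<integral>\<^sup>+z. ennreal ((dual_pairing j (ex (Suc n)) z)\<^sup>2) \<partial>M)"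
      by (subst nn_integral_add) (auto simp: emeasure_space_1)
    also have "\<dots> \<le> 1 + ennreal K"
      using second_moment[of "ex (Suc n)"] ex[of "Suc n"] by (intro add_left_mono) simp
    also have "\<dots> = ennreal (1 + K)"
      using \<open>0 \<le> K\<close> by simp
    finally show "(\<integral>\<^sup>+z. ennreal (2 powr (- real (Suc n) / 2) * \<bar>dual_pairing j (ex (Suc n)) z\<bar>) \<partial>M)
        \<le> ennreal (2 powr (- real (Suc n) / 2) * (1 + K))"
      using \<open>0 \<le> K\<close> by (simp add: ennreal_mult' nn_integral_cmult mult_left_mono)
  next
    show "summable (\<lambda>n. 2 powr (- real (Suc n) / 2) * (1 + K))"
      by (intro summable_mult2 summable_2_powr_half)
  qed (use \<open>0 \<le> K\<close> in auto)
  ultimately show ?thesis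
    using nonneg by (simp add: E_sub_iff_summable)
qed

section \<open>\<open>E_x\<close> contains \<open>H\<close> but not \<open>x\<close>\<close>

lemma range_subset_E_sub:
  assumes "dense_embedding j"
    and e: "\<And>n. n \<ge> 1 \<Longrightarrow> e n \<in> dual_in j \<and> norm (e n) = 1"
    and ex: "\<And>n. n \<ge> 1 \<Longrightarrow> ex n \<in> dual_in j \<and> norm (ex n) = 1"
    and nonneg: "\<And>n. n \<ge> 1 \<Longrightarrow> 0 \<le> \<alpha> n * lam n"
    and sum: "summable (\<lambda>n. \<alpha> (Suc n) * lam (Suc n))"
  shows "range j \<subseteq> E_sub j e lam \<alpha> ex"
proof
  fix z
  assume "z \<in> range j"
  then obtain h where z: "z = j h"
    by auto
  \<comment> \<open>On \<open>H\<close> the pairing is the inner product, so Cauchy-Schwarz bounds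
    it uniformly over unit vectors. Both series are then dominated by constant multiples of their
    weights.\<close>
  have pairing_le: "\<bar>dual_pairing j \<xi> z\<bar> \<le> norm h" if "\<xi> \<in> dual_in j \<and> norm \<xi> = 1" for \<xi>
    using that assms(1) Cauchy_Schwarz_ineq2[of \<xi> h] by (simp add: z dual_pairing_embedding)
  have "summable (\<lambda>n. \<alpha> (Suc n) * lam (Suc n) * (dual_pairing j (e (Suc n)) z)\<^sup>2)"
  proof (rule summable_comparison_test'[OF summable_mult2[OF sum]])
    show "norm (\<alpha> (Suc n) * lam (Suc n) * (dual_pairing j (e (Suc n)) z)\<^sup>2)
        \<le> \<alpha> (Suc n) * lam (Suc n) * (norm h)\<^sup>2" for n
      using nonneg[of "Suc n"] power_mono[OF pairing_le[OF e[of "Suc n"]], of 2]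
      by (simp add: mult_left_mono)
  qed
  moreover have "summable (\<lambda>n. 2 powr (- real (Suc n) / 2) * \<bar>dual_pairing j (ex (Suc n)) z\<bar>)"
  proof (rule summable_comparison_test'[OF summable_mult2[OF summable_2_powr_half]])
    show "norm (2 powr (- real (Suc n) / 2) * \<bar>dual_pairing j (ex (Suc n)) z\<bar>)
        \<le> 2 powr (- real (Suc n) / 2) * norm h" for n
      using pairing_le[OF ex[of "Suc n"]] by (simp add: abs_mult)
  qed
  ultimately show "z \<in> E_sub j e lam \<alpha> ex"
    using nonneg by (simp add: E_sub_iff_summable)
qed

text \<open>The lower bound \<open>2^(n/2)\<close> is the reciprocal of the weight in the second
  series, so its terms at \<open>x\<close> do not tend to 0.\<close>

lemma not_in_E_sub:
  assumes nonneg: "\<And>n. n \<ge> 1 \<Longrightarrow> 0 \<le> \<alpha> n * lam n"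
    and large: "\<And>n. n \<ge> 1 \<Longrightarrow> dual_pairing j (ex n) x \<ge> 2 powr (real n / 2)"
  shows "x \<notin> E_sub j e lam \<alpha> ex"
proof
  assume "x \<in> E_sub j e lam \<alpha> ex"
  then have "(\<lambda>n. 2 powr (- real (Suc n) / 2) * \<bar>dual_pairing j (ex (Suc n)) x\<bar>) \<longlonglongrightarrow> 0"
    using nonneg by (intro summable_LIMSEQ_zero) (simp add: E_sub_iff_summable)
  moreover have "1 \<le> 2 powr (- real (Suc n) / 2) * \<bar>dual_pairing j (ex (Suc n)) x\<bar>" for n
  proof -
    have "1 = 2 powr (- real (Suc n) / 2) * 2 powr (real (Suc n) / 2)"
      by (simp add: field_simps flip: powr_add)
    also have "\<dots> \<le> 2 powr (- real (Suc n) / 2) * \<bar>dual_pairing j (ex (Suc n)) x\<bar>"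
      using large[of "Suc n"] by (intro mult_left_mono) auto
    finally show ?thesis .
  qed
  ultimately have "1 \<le> (0::real)"
    by (intro LIMSEQ_le_const) auto
  then show False
    by simp
qed

section \<open>Invariance of the indicator and conclusion\<close>

lemma transition_op_indicator_subspace:
  fixes S :: "'e::real_normed_vector set"
  assumes "prob_space (\<nu> t)" and sets: "sets (\<nu> t) = sets borel"
    and S: "S \<in> sets borel" "subspace S" and AE_S: "AE w in \<nu> t. w \<in> S"
  shows "transition_op \<nu> t (indicat_real S) = indicat_real S"
proof
  fix y
  interpret prob_space "\<nu> t" by fact
  \<comment> \<open>For the forward direction \<open>y\<close> is recovered as
    \<open>(y + w) - w\<close>. As almost every \<open>w\<close> lies in \<open>S\<close>, the
    integrand below agrees almost everywhere with a constant.\<close>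
  have "y + w \<in> S \<longleftrightarrow> y \<in> S" if "w \<in> S" for w
    using subspace_add[OF S(2), of y w] subspace_diff[OF S(2), of "y + w" w] that by auto
  then have "AE w in \<nu> t. indicat_real S (y + w) = indicat_real S y"
    using AE_S by (auto simp: indicator_def elim: eventually_mono)
  \<comment> \<open>\<open>integral_cong_AE\<close> requires measurability; translation by
    \<open>y\<close> is continuous, hence Borel.\<close>
  moreover have "(\<lambda>w. indicat_real S (y + w)) \<in> borel_measurable (\<nu> t)"
  proof -
    have "(\<lambda>w. y + w) \<in> borel_measurable borel"
      by (intro borel_measurable_continuous_onI continuous_intros)
    moreover have "indicat_real S \<in> borel_measurable borel"
      using S(1) by simp
    ultimately show ?thesis
      unfolding measurable_cong_sets[OF sets refl] by (rule measurable_compose)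
  qed
  ultimately have "(\<integral>w. indicat_real S (y + w) \<partial>\<nu> t) = (\<integral>w. indicat_real S y \<partial>\<nu> t)"
    by (intro integral_cong_AE) auto
  then show "transition_op \<nu> t (indicat_real S) y = indicat_real S y"
    by (simp add: transition_op_def prob_space)
qed

text \<open>The Borel property belongs to the conclusion: it ensures that the Bochner integral in
  \<open>transition_op\<close> is that of a bounded measurable function, not the default value
  0.\<close>

theorem mainTheorem12:
  fixes j :: "'h::{real_inner, polish_space} \<Rightarrow> 'e::{real_inner, complete_space}"
    and \<psi> :: "'h \<Rightarrow> complex"
    and \<nu> :: "real \<Rightarrow> 'e measure"
    and e ex :: "nat \<Rightarrow> 'h"
    and lam \<alpha> :: "nat \<Rightarrow> real"
    and x :: 'e
  assumes embedding: "dense_embedding j"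
    and infinite_dim: "\<not> (\<exists>B :: 'h set. finite B \<and> span B = UNIV)"
    and HS: "Hilbert_Schmidt j"
    and psi: "continuous_on UNIV \<psi>" "negative_definite \<psi>" "\<psi> 0 = 0"
    and nu_prob: "\<And>t. t > 0 \<Longrightarrow> prob_space (\<nu> t)"
    and nu_sets: "\<And>t. t > 0 \<Longrightarrow> sets (\<nu> t) = sets borel"
    and nu_char: "\<And>t \<xi>. t > 0 \<Longrightarrow> \<xi> \<in> dual_in j \<Longrightarrow>
      (CLINT z|\<nu> t. exp (\<i> * complex_of_real (dual_pairing j \<xi> z))) = exp (- of_real t * \<psi> \<xi>)"
    and H_i: "\<exists>C>0. \<forall>\<xi>\<in>dual_in j. \<forall>t>0.
      (\<integral>\<^sup>+z. ennreal ((dual_pairing j \<xi> z)\<^sup>2) \<partial>\<nu> t) \<le> ennreal (C * (1 + t\<^sup>2) * (norm \<xi>)\<^sup>2)"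
    and H_ii: "\<And>t. t > 0 \<Longrightarrow> range j \<in> null_sets (\<nu> t)"
    and e_basis: "orthonormal_basis {1..} e" "e ` {1..} \<subseteq> dual_in j"
    and lambda: "\<And>n. n \<ge> 1 \<Longrightarrow> lam n > 0" "summable (\<lambda>n. lam (Suc n))"
    and ebar_basis: "orthonormal_basis {1..} (\<lambda>n. j (e n) /\<^sub>R sqrt (lam n))"
    and e_pairing: "\<And>n z. n \<ge> 1 \<Longrightarrow> lam n * dual_pairing j (e n) z = j (e n) \<bullet> z"
    and alpha: "\<And>n. n \<ge> 1 \<Longrightarrow> \<alpha> n > 0" "mono_on {1..} \<alpha>" "filterlim \<alpha> at_top sequentially"
      "summable (\<lambda>n. \<alpha> (Suc n) * lam (Suc n))"
    and x: "x \<notin> range j"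
    and ex_basis: "orthonormal_basis {1..} ex" "ex ` {1..} \<subseteq> dual_in j"
    and ex_separates: "\<And>z w. z \<noteq> w \<Longrightarrow> \<exists>n\<ge>1. dual_pairing j (ex n) z \<noteq> dual_pairing j (ex n) w"
    and ex_large: "\<And>n. n \<ge> 1 \<Longrightarrow> dual_pairing j (ex n) x \<ge> 2 powr (real n / 2)"
  shows "E_sub j e lam \<alpha> ex \<in> sets borel \<and> subspace (E_sub j e lam \<alpha> ex) \<and>
    (\<forall>t>0. transition_op \<nu> t (indicat_real (E_sub j e lam \<alpha> ex)) = indicat_real (E_sub j e lam \<alpha> ex)) \<and>
    (\<forall>h. indicat_real (E_sub j e lam \<alpha> ex) (j h) = 1) \<and>
    indicat_real (E_sub j e lam \<alpha> ex) x = 0"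
proof -
  let ?S = "E_sub j e lam \<alpha> ex"
  have nonneg: "0 \<le> \<alpha> n * lam n" if "n \<ge> 1" for n
    using alpha(1)[OF that] lambda(1)[OF that] by simp
  have e: "e n \<in> dual_in j \<and> norm (e n) = 1" if "n \<ge> 1" for n
    using e_basis that by (auto simp: orthonormal_basis_def norm_eq_1)
  have ex: "ex n \<in> dual_in j \<and> norm (ex n) = 1" if "n \<ge> 1" for n
    using ex_basis that by (auto simp: orthonormal_basis_def norm_eq_1)
  have S: "subspace ?S"
    using nonneg by (rule subspace_E_sub)
  obtain C where "C > 0" and C: "\<And>\<xi> t. \<xi> \<in> dual_in j \<Longrightarrow> t > 0 \<Longrightarrow>
      (\<integral>\<^sup>+z. ennreal ((dual_pairing j \<xi> z)\<^sup>2) \<partial>\<nu> t) \<le> ennreal (C * (1 + t\<^sup>2) * (norm \<xi>)\<^sup>2)"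
    using H_i by blast
  have "transition_op \<nu> t (indicat_real ?S) = indicat_real ?S" if "t > 0" for t
  proof (rule transition_op_indicator_subspace)
    show "prob_space (\<nu> t)"
      using that by (rule nu_prob)
    show "sets (\<nu> t) = sets borel"
      using that by (rule nu_sets)
    show "?S \<in> sets borel"
      by (rule borel_E_sub)
    show "subspace ?S"
      by (rule S)
    show "AE w in \<nu> t. w \<in> ?S"
      \<comment> \<open>Unification with the moment bound sets \<open>K\<close> to
        \<open>C * (1 + t^2)\<close>, a constant for fixed \<open>t\<close>. The placeholder leaves
        its nonnegativity as the remaining goal.\<close>
      using nu_prob[OF that] nu_sets[OF that] _ C[OF _ that] e ex nonneg alpha(4)
      by (rule AE_E_sub) (use \<open>C > 0\<close> in auto)
  qed
  moreover have "j h \<in> ?S" for h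
    using range_subset_E_sub[of j e ex \<alpha> lam] embedding e ex nonneg alpha(4) by blast
  moreover have "x \<notin> ?S"
    using nonneg ex_large by (rule not_in_E_sub)
  ultimately show ?thesis
    using S borel_E_sub by auto
qed

end
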